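(* Let $(a_n)_{n \geq 1}$ be a sequence of non-negative real numbers and suppose that $a_n = n^{\alpha + o(1)}$ as $n \to \infty$ for some constant $\alpha > 1/2$. Then the Rademacher random walk associated with $(a_n)_{n\ge 1}$ is transient.
   Context: Let $\epsilon_1, \epsilon_2, \dots$ be independent Rademacher random variables, taking values $\pm 1$ each with probability $1/2$. The Rademacher random walk associated with a deterministic sequence $(a_n)_{n\ge1}$ of non-negative reals is $(X_n)_{n\ge 0}$, $X_n = \sum_{k=1}^n \epsilon_k a_k$ (so $X_0=0$). The walk is weakly recurrent if $\mathbb{P}(\exists C<\infty : |X_n| \le C \text{ for infinitely many } n) = 1$; otherwise it is called transient (the event is a tail event, so by Kolmogorov's zero-one law transience means its probability is $0$). The notation $a_n = n^{\alpha+o(1)}$ means that for every $\delta>0$ one has $n^{\alpha-\delta}\le a_n\le n^{\alpha+\delta}$ for all sufficiently large $n$. *)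

theory Defs
  imports "HOL-Probability.Probability"
begin

(* Sequences are indexed by n \<ge> 1; the values at index 0 are unconstrained and never used. *)
locale rademacher_sequence = prob_space M
  for M :: "'w measure" and \<epsilon> :: "nat \<Rightarrow> 'w \<Rightarrow> real" +
  assumes indep: "indep_vars (\<lambda>_. borel) \<epsilon> {1..}"
    and prob_plus: "\<And>n. n \<ge> 1 \<Longrightarrow> prob {w \<in> space M. \<epsilon> n w = 1} = 1 / 2"
    and prob_minus: "\<And>n. n \<ge> 1 \<Longrightarrow> prob {w \<in> space M. \<epsilon> n w = - 1} = 1 / 2"

definition rademacher_walk :: "(nat \<Rightarrow> 'w \<Rightarrow> real) \<Rightarrow> (nat \<Rightarrow> real) \<Rightarrow> nat \<Rightarrow> 'w \<Rightarrow> real" where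
  "rademacher_walk \<epsilon> a n w = (\<Sum>k = 1..n. \<epsilon> k w * a k)"

definition weakly_recurrent :: "'w measure \<Rightarrow> (nat \<Rightarrow> 'w \<Rightarrow> real) \<Rightarrow> bool" where
  "weakly_recurrent M X \<longleftrightarrow>
     measure M {w \<in> space M. \<exists>C. infinite {n. \<bar>X n w\<bar> \<le> C}} = 1"

definition transient :: "'w measure \<Rightarrow> (nat \<Rightarrow> 'w \<Rightarrow> real) \<Rightarrow> bool" where
  "transient M X \<longleftrightarrow> \<not> weakly_recurrent M X"

(* a n = n powr (\<alpha> + o(1)) *)
definition has_growth_exponent :: "(nat \<Rightarrow> real) \<Rightarrow> real \<Rightarrow> bool" where
  "has_growth_exponent a \<alpha> \<longleftrightarrow>
     (\<forall>\<delta>>0. \<forall>\<^sub>F n in sequentially.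
        real n powr (\<alpha> - \<delta>) \<le> a n \<and> a n \<le> real n powr (\<alpha> + \<delta>))"

(* The measure of a non-measurable set is 0 by convention, so the definition of
   weak recurrence is meaningful only because the event in it is measurable. *)
lemma weak_recurrence_event_measurable:
  fixes X :: "nat \<Rightarrow> 'w \<Rightarrow> real"
  assumes "\<And>n. X n \<in> borel_measurable M"
  shows "{w \<in> space M. \<exists>C. infinite {n. \<bar>X n w\<bar> \<le> (C::real)}} \<in> sets M"
proof -
  have "(\<exists>C. infinite {n. \<bar>X n w\<bar> \<le> C}) \<longleftrightarrow>
        (\<exists>N::nat. \<forall>m. \<exists>n\<ge>m. \<bar>X n w\<bar> \<le> real N)" for w
  proof
    assume "\<exists>C. infinite {n. \<bar>X n w\<bar> \<le> C}"
    then obtain C where C: "infinite {n. \<bar>X n w\<bar> \<le> C}" by blast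
    obtain N :: nat where "C \<le> real N" using real_arch_simple by blast
    then have "{n. \<bar>X n w\<bar> \<le> C} \<subseteq> {n. \<bar>X n w\<bar> \<le> real N}" by auto
    with C have "infinite {n. \<bar>X n w\<bar> \<le> real N}" by (rule infinite_super[rotated])
    then show "\<exists>N::nat. \<forall>m. \<exists>n\<ge>m. \<bar>X n w\<bar> \<le> real N"
      unfolding infinite_nat_iff_unbounded_le by auto
  next
    assume "\<exists>N::nat. \<forall>m. \<exists>n\<ge>m. \<bar>X n w\<bar> \<le> real N"
    then show "\<exists>C. infinite {n. \<bar>X n w\<bar> \<le> C}"
      unfolding infinite_nat_iff_unbounded_le by auto
  qed
  then have "{w \<in> space M. \<exists>C. infinite {n. \<bar>X n w\<bar> \<le> C}} =
             {w \<in> space M. \<exists>N::nat. \<forall>m. \<exists>n. n \<ge> m \<and> \<bar>X n w\<bar> \<le> real N}" by simp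
  also have "\<dots> \<in> sets M" using assms by measurable
  finally show ?thesis .
qed

lemma (in rademacher_sequence) rademacher_walk_measurable:
  "rademacher_walk \<epsilon> a n \<in> borel_measurable M"
proof -
  have "\<epsilon> k \<in> borel_measurable M" if "k \<ge> 1" for k
    using indep that by (auto simp: indep_vars_def)
  then show ?thesis
    unfolding rademacher_walk_def [abs_def]
    by (intro borel_measurable_sum borel_measurable_times) auto
qed

end

theory Submission
  imports Defs "HOL-Real_Asymp.Real_Asymp"
begin

text \<open>
  Why the walk escapes: the probability that $|X_n| \le C$ turns out to be of order at most
  $n^{-1-\delta}$ for some $\delta > 0$, so Borel--Cantelli applies to each fixed $C$.

  The bound comes from the characteristic function, which for independent signs is
  $\varphi_n(t) = \prod_{k \le n} \cos(t a_k)$ (lemma \<open>char_rademacher_walk\<close>). For small $t$ the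
  indices with $a_k \approx 1/t$ are those near $t^{-1/\alpha}$; a dyadic block of such indices makes the
  product smaller than $\exp(-c t^{-1/\alpha})$, up to $o(1)$ errors in the exponents, provided that
  $t^{-1/\alpha} \le n$. Otherwise the block near $n$ still contributes about $t^2 n^{2\alpha+1}$ to the
  exponent. Hence
  $\varphi_n$ is negligible on the whole range from $n^{-\alpha-1/2+2\delta}$ to $n^{-\eta}$ with
  $\eta > 0$ (lemma \<open>abs_prod_cos_stretched_exponential\<close>).

  To turn this into a small-ball estimate, sample the frequencies $t = jh$ with $0 \le j < N$, where
  $h$ is the lower end of this range and $Nh$ its upper end. Positivity of the Fejer sum
  $|\sum_{j<N} e^{ijhX}|^2$ gives $P(|X| \le 1/(Nh)) \le 4(1/N + \max_{1\le j<N} |\varphi(jh)|)$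
  (lemma \<open>small_ball_le_char\<close>). The ratio of the end points is
  $N \approx n^{\alpha + 1/2 - 2\delta - \eta}$. Asking for $N \approx n^{1+\delta}$ forces
  $\eta = \alpha - 1/2 - 3\delta$, which is positive for small $\delta$ exactly because $\alpha > 1/2$;
  then the radius $1/(Nh) \approx n^\eta$ eventually exceeds any constant $C$.
\<close>

section \<open>A small-ball inequality from sampled frequencies\<close>

text \<open>
  Both sides are $|\sum_{j<N} e^{ijx}|^2$. The left one has expectations that are values of a
  characteristic function; the right one is visibly nonnegative.
\<close>
lemma fejer_square:
  fixes x :: real
  shows "(\<Sum>j<N. \<Sum>l<N. cos ((real j - real l) * x)) =
         (\<Sum>j<N. cos (real j * x))\<^sup>2 + (\<Sum>j<N. sin (real j * x))\<^sup>2"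
  by (simp add: left_diff_distrib cos_diff power2_eq_square sum_product sum.distrib)

lemma cos_ge_one_minus_square: "1 - x\<^sup>2 / 2 \<le> cos (x::real)"
proof -
  have "(sin (x / 2))\<^sup>2 \<le> (x / 2)\<^sup>2"
    using abs_sin_x_le_abs_x[of "x / 2"] by (simp only: abs_le_square_iff)
  then show ?thesis
    using cos_double_sin[of "x / 2"] by (simp add: power_divide)
qed

lemma abs_cos_le_exp:
  fixes x :: real
  assumes "\<bar>x\<bar> \<le> 1"
  shows "\<bar>cos x\<bar> \<le> exp (- (x\<^sup>2 / 4))"
proof -
  have sq: "x\<^sup>2 \<le> 1"
    using assms by (simp add: abs_square_le_1)
  obtain t where taylor: "cos x = (\<Sum>m<4. cos_coeff m * x ^ m) + cos (t + 1 / 2 * real 4 * pi) / fact 4 * x ^ 4"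
    using Maclaurin_cos_expansion[of x 4] by blast
  define R where "R = cos (t + 1 / 2 * real 4 * pi) / fact 4 * x ^ 4"
  have "(\<Sum>m<4. cos_coeff m * x ^ m) = 1 - x\<^sup>2 / 2"
    by (simp add: lessThan_nat_numeral lessThan_Suc cos_coeff_def fact_numeral)
  then have cos_x: "cos x = 1 - x\<^sup>2 / 2 + R"
    using taylor by (simp only: R_def)
  have "R \<le> 1 / 24 * x ^ 4"
    unfolding R_def by (intro mult_right_mono) (auto simp: fact_numeral)
  also have "\<dots> \<le> x\<^sup>2 / 24"
    using mult_right_mono[OF sq, of "x\<^sup>2"] by (simp add: power4_eq_xxxx power2_eq_square mult.assoc)
  finally have "cos x \<le> 1 - x\<^sup>2 / 4"
    using cos_x zero_le_power2[of x] by linarith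
  also have "\<dots> \<le> exp (- (x\<^sup>2 / 4))"
    using exp_ge_add_one_self[of "- (x\<^sup>2 / 4)"] by simp
  finally have "cos x \<le> exp (- (x\<^sup>2 / 4))" .
  moreover have "0 \<le> cos x"
    using cos_ge_one_minus_square[of x] sq by simp
  ultimately show ?thesis by simp
qed

text \<open>
  A discrete form of Esseen's concentration inequality. The Fejer sum of $hX$ is nonnegative
  everywhere and at least $N^2/4$ when $N|hX| \le 1$, since then every cosine is at least $1/2$. In its
  expectation the $N$ diagonal terms contribute 1 each and the others at most $B$. Sampling at
  multiples of $h$ replaces the usual integral over frequencies by a finite sum; the resulting
  periodicity in $X$ can only enlarge the sum, so it does no harm to an upper bound.
\<close>
lemma (in prob_space) small_ball_le_char:
  assumes X [measurable]: "X \<in> borel_measurable M"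
    and N: "N \<ge> 1" and B: "0 \<le> B"
    and char_le: "\<And>j. 1 \<le> j \<Longrightarrow> j < N \<Longrightarrow> cmod (char (distr M borel X) (real j * h)) \<le> B"
  shows "prob {w \<in> space M. real N * \<bar>h * X w\<bar> \<le> 1} \<le> 4 * (1 / real N + B)"
proof -
  let ?A = "{w \<in> space M. real N * \<bar>h * X w\<bar> \<le> 1}"
  define F where "F w = (\<Sum>j<N. \<Sum>l<N. cos ((real j - real l) * (h * X w)))" for w
  have integrable_cos: "integrable M (\<lambda>w. cos (t * (h * X w)))" for t
    by (rule integrable_const_bound[where B = 1]) auto
  have expectation_cos: "expectation (\<lambda>w. cos ((real j - real l) * (h * X w))) \<le> (if j = l then 1 else B)"
    if "j < N" "l < N" for j l
  proof (cases "j = l")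
    case True
    then show ?thesis by (simp add: prob_space)
  next
    case False
    (* cos is even, so only the distance between the two indices matters. *)
    define d where "d = (if l < j then j - l else l - j)"
    have d: "1 \<le> d" "d < N" using False that by (auto simp: d_def)
    have "cos ((real j - real l) * (h * X w)) = Re (iexp ((real d * h) * X w))" for w
      using False cos_minus[of "(real j - real l) * (h * X w)"]
      by (auto simp: d_def of_nat_diff algebra_simps Re_exp)
    moreover have "integrable M (\<lambda>w. iexp ((real d * h) * X w))"
      by (rule integrable_const_bound[where B = 1]) auto
    ultimately have "expectation (\<lambda>w. cos ((real j - real l) * (h * X w))) = Re (char (distr M borel X) (real d * h))"
      by (simp add: char_def integral_distr)
    also have "\<dots> \<le> B"
      using char_le[OF d] complex_Re_le_cmod order_trans by blast
    finally show ?thesis using False by simp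
  qed
  have "(real N)\<^sup>2 / 4 * prob ?A = expectation (\<lambda>w. (real N)\<^sup>2 / 4 * indicator ?A w)"
    by simp
  also have "\<dots> \<le> expectation F"
  proof (rule integral_mono)
    show "integrable M (\<lambda>w. (real N)\<^sup>2 / 4 * indicator ?A w)"
      by (auto intro!: integrable_mult_right integrable_real_indicator simp: emeasure_eq_measure)
    show "integrable M F"
      unfolding F_def by (intro Bochner_Integration.integrable_sum integrable_cos)
    fix w assume w: "w \<in> space M"
    show "(real N)\<^sup>2 / 4 * indicator ?A w \<le> F w"
    proof (cases "w \<in> ?A")
      case False
      then show ?thesis by (simp add: F_def fejer_square)
    next
      case True
      have "1 / 2 \<le> cos (real j * (h * X w))" if "j < N" for j
      proof -
        have "\<bar>real j * (h * X w)\<bar> \<le> real N * \<bar>h * X w\<bar>"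
          using that by (simp add: abs_mult mult_right_mono)
        then have "(real j * (h * X w))\<^sup>2 \<le> 1"
          using True by (intro abs_square_le_1[THEN iffD2]) simp
        then show ?thesis
          using cos_ge_one_minus_square[of "real j * (h * X w)"] by simp
      qed
      then have "(\<Sum>j<N. 1 / 2) \<le> (\<Sum>j<N. cos (real j * (h * X w)))"
        by (intro sum_mono) auto
      then have "(real N / 2)\<^sup>2 \<le> (\<Sum>j<N. cos (real j * (h * X w)))\<^sup>2"
        by (intro power_mono) auto
      then show ?thesis
        using True by (simp add: F_def fejer_square power_divide add_increasing2)
    qed
  qed
  also have "\<dots> = (\<Sum>j<N. \<Sum>l<N. expectation (\<lambda>w. cos ((real j - real l) * (h * X w))))"
    unfolding F_def by (simp add: integrable_cos)
  also have "\<dots> \<le> (\<Sum>j<N. \<Sum>l<N. (if j = l then 1 else 0) + B)"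
    by (intro sum_mono order_trans[OF expectation_cos]) (use B in auto)
  also have "\<dots> = real N + (real N)\<^sup>2 * B"
    by (simp add: sum.distrib power2_eq_square algebra_simps)
  also have "\<dots> = (real N)\<^sup>2 / 4 * (4 * (1 / real N + B))"
    using N by (simp add: field_simps power2_eq_square)
  finally show ?thesis
    by (rule mult_left_le_imp_le) (use N in simp)
qed

section \<open>The characteristic function of the walk\<close>

lemma (in rademacher_sequence) char_rademacher_walk:
  "char (distr M borel (rademacher_walk \<epsilon> a n)) t = (\<Prod>k=1..n. of_real (cos (t * a k)))"
proof -
  have eps [measurable]: "\<epsilon> k \<in> borel_measurable M" if "k \<ge> 1" for k
    using indep that by (auto simp: indep_vars_def)
  have "indep_vars (\<lambda>_. borel) (\<lambda>k w. \<epsilon> k w * a k) {1..n}"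
    by (rule indep_vars_compose2[where X = \<epsilon> and M' = "\<lambda>_. borel"])
       (auto intro: indep_vars_subset[OF indep])
  then have "char (distr M borel (rademacher_walk \<epsilon> a n)) t
      = (\<Prod>k=1..n. char (distr M borel (\<lambda>w. \<epsilon> k w * a k)) t)"
    unfolding rademacher_walk_def[abs_def] by (rule char_distr_sum)
  also have "\<dots> = (\<Prod>k=1..n. of_real (cos (t * a k)))"
  proof (rule prod.cong[OF refl])
    fix k assume "k \<in> {1..n}"
    then have k: "k \<ge> 1" by simp
    note [measurable] = eps[OF k]
    let ?P = "{w \<in> space M. \<epsilon> k w = 1}" and ?Q = "{w \<in> space M. \<epsilon> k w = - 1}"
    have "prob (?P \<union> ?Q) = prob ?P + prob ?Q"
      by (rule finite_measure_Union) auto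
    also have "\<dots> = 1"
      using prob_plus[OF k] prob_minus[OF k] by simp
    finally have "AE w in M. w \<in> ?P \<union> ?Q"
      by (intro prob_eq_1[THEN iffD1]) auto
    then have ae: "AE w in M. iexp (t * (\<epsilon> k w * a k)) =
        indicator ?P w *\<^sub>R iexp (t * a k) + indicator ?Q w *\<^sub>R iexp (- (t * a k))"
      by (rule AE_mp) (auto intro!: AE_I2 simp: indicator_def)
    have "char (distr M borel (\<lambda>w. \<epsilon> k w * a k)) t = (CLINT w|M. iexp (t * (\<epsilon> k w * a k)))"
      by (simp add: char_def integral_distr)
    also have "\<dots> = (CLINT w|M. indicator ?P w *\<^sub>R iexp (t * a k) + indicator ?Q w *\<^sub>R iexp (- (t * a k)))"
      by (rule integral_cong_AE) (use ae in auto)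
    also have "\<dots> = prob ?P *\<^sub>R iexp (t * a k) + prob ?Q *\<^sub>R iexp (- (t * a k))"
      by (subst Bochner_Integration.integral_add) (auto simp: emeasure_eq_measure)
    also have "\<dots> = of_real (cos (t * a k))"
      unfolding prob_plus[OF k] prob_minus[OF k] by (simp add: complex_eq_iff Re_exp Im_exp)
    finally show "char (distr M borel (\<lambda>w. \<epsilon> k w * a k)) t = of_real (cos (t * a k))" .
  qed
  finally show ?thesis .
qed
text \<open>
  The lower bound $l$ makes each factor of the block small, and the upper bound $t a_k \le 1$ keeps its
  argument in the range where the cosine is dominated by a Gaussian. Without the latter, $t a_k$
  could be a multiple of $\pi$. All factors outside the block are bounded by 1.
\<close>
lemma abs_prod_cos_le_exp:
  fixes a :: "nat \<Rightarrow> real"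
  assumes j: "2 * j \<le> n"
    and a: "\<And>k. j < k \<Longrightarrow> k \<le> 2 * j \<Longrightarrow> l \<le> a k \<and> t * a k \<le> 1"
    and l: "0 \<le> l" and t: "0 \<le> t"
  shows "\<bar>\<Prod>k=1..n. cos (t * a k)\<bar> \<le> exp (- (real j * (t * l)\<^sup>2 / 4))"
proof -
  have "\<bar>\<Prod>k=1..n. cos (t * a k)\<bar> = (\<Prod>k=1..n. \<bar>cos (t * a k)\<bar>)"
    by (rule abs_prod)
  also have "\<dots> \<le> (\<Prod>k=1..n. if k \<in> {j<..2 * j} then exp (- ((t * l)\<^sup>2 / 4)) else 1)"
  proof (rule prod_mono)
    fix k
    have "\<bar>cos (t * a k)\<bar> \<le> exp (- ((t * l)\<^sup>2 / 4))" if "k \<in> {j<..2 * j}"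
    proof -
      have ak: "l \<le> a k" "t * a k \<le> 1"
        using a[of k] that by auto
      then have tl: "0 \<le> t * l" "t * l \<le> t * a k"
        using l t by (auto intro: mult_left_mono)
      then have "\<bar>cos (t * a k)\<bar> \<le> exp (- ((t * a k)\<^sup>2 / 4))"
        using ak by (intro abs_cos_le_exp) auto
      also have "\<dots> \<le> exp (- ((t * l)\<^sup>2 / 4))"
        using power_mono[OF tl(2,1), of 2] by simp
      finally show ?thesis .
    qed
    then show "0 \<le> \<bar>cos (t * a k)\<bar> \<and>
        \<bar>cos (t * a k)\<bar> \<le> (if k \<in> {j<..2 * j} then exp (- ((t * l)\<^sup>2 / 4)) else 1)"
      by simp
  qed
  also have "\<dots> = (\<Prod>k\<in>{1..n} \<inter> {j<..2 * j}. exp (- ((t * l)\<^sup>2 / 4)))"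
    by (rule prod.inter_restrict[symmetric]) simp
  also have "{1..n} \<inter> {j<..2 * j} = {j<..2 * j}"
    using j by auto
  also have "(\<Prod>k\<in>{j<..2 * j}. exp (- ((t * l)\<^sup>2 / 4))) = exp (- (real j * (t * l)\<^sup>2 / 4))"
    by (simp add: exp_of_nat_mult[symmetric])
  finally show ?thesis .
qed

text \<open>
  With $y = t^{-1/(\alpha+\delta)}$, all large indices $k \le y$ satisfy $t a_k \le 1$, so the block
  $(j, 2j]$ should be placed with $2j$ just below $r = \min(n, y)$. It contributes about
  $r^{1+2(\alpha-\delta)} t^2$ to the exponent. If $r = y$ this is $y^{1-4\delta}$, which is a
  power of $n$ because $t \le n^{-\eta}$ forces $y \ge n^{\eta/(\alpha+\delta)}$. If $r = n$ it is at
  least $n^{2\delta}$, which is what fixes the lower end of the range of $t$.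
\<close>
lemma abs_prod_cos_stretched_exponential:
  fixes a :: "nat \<Rightarrow> real"
  assumes \<delta>: "0 < \<delta>" "\<delta> < 1 / 4" "\<delta> < \<alpha>" and \<eta>: "0 < \<eta>"
    and growth: "\<forall>\<^sub>F n in sequentially.
        real n powr (\<alpha> - \<delta>) \<le> a n \<and> a n \<le> real n powr (\<alpha> + \<delta>)"
  shows "\<exists>c>0. \<exists>\<kappa>>0. \<forall>\<^sub>F n in sequentially. \<forall>t.
      real n powr - (\<alpha> + 1 / 2 - 2 * \<delta>) \<le> t \<and> t \<le> real n powr - \<eta> \<longrightarrow>
      \<bar>\<Prod>k=1..n. cos (t * a k)\<bar> \<le> exp (- (c * real n powr \<kappa>))"
proof -
  define \<beta> where "\<beta> = \<alpha> - \<delta>"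
  define \<gamma> where "\<gamma> = \<alpha> + \<delta>"
  define \<kappa> where "\<kappa> = min (2 * \<delta>) (\<eta> / \<gamma> * (1 - 4 * \<delta>))"
  define c where "c = (1 / 4) powr (1 + 2 * \<beta>) / 4"
  have pos: "0 < \<beta>" "0 < \<gamma>" "0 < \<kappa>" "0 < c" "0 < \<eta> / \<gamma>"
    using \<delta> \<eta> by (auto simp: \<beta>_def \<gamma>_def \<kappa>_def c_def)
  obtain k0 where k0: "real k powr \<beta> \<le> a k" "a k \<le> real k powr \<gamma>" if "k \<ge> k0" for k
    using growth unfolding eventually_sequentially \<beta>_def \<gamma>_def by blast
  (* The factor 4 ensures that the block starts beyond k0, and the added 1 that rounding r / 2
     down loses at most half of it. *)
  have "\<forall>\<^sub>F n in sequentially. 4 * (real k0 + 1) \<le> real n"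
    by real_asymp
  moreover have "\<forall>\<^sub>F n in sequentially. 4 * (real k0 + 1) \<le> real n powr (\<eta> / \<gamma>)"
    using pos(5) by real_asymp
  ultimately have "\<forall>\<^sub>F n in sequentially. \<forall>t.
      real n powr - (\<alpha> + 1 / 2 - 2 * \<delta>) \<le> t \<and> t \<le> real n powr - \<eta> \<longrightarrow>
      \<bar>\<Prod>k=1..n. cos (t * a k)\<bar> \<le> exp (- (c * real n powr \<kappa>))"
  proof eventually_elim
    case (elim n)
    have n: "1 \<le> real n" using elim(1) by simp
    show ?case
    proof (intro allI impI, elim conjE)
      fix t
      assume t_ge: "real n powr - (\<alpha> + 1 / 2 - 2 * \<delta>) \<le> t" and t_le: "t \<le> real n powr - \<eta>"
      have "0 < real n powr - (\<alpha> + 1 / 2 - 2 * \<delta>)" using n by simp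
      then have t: "0 < t" using t_ge by linarith
      define y where "y = t powr (- 1 / \<gamma>)"
      define r where "r = min (real n) y"
      define j where "j = nat \<lfloor>r / 2\<rfloor>"
      have t_y: "t = y powr - \<gamma>" and y: "0 < y"
        using t pos by (auto simp: y_def powr_powr)
      have "real n powr (\<eta> / \<gamma>) = (real n powr - \<eta>) powr (- 1 / \<gamma>)"
        by (simp add: powr_powr)
      also have "\<dots> \<le> y"
        unfolding y_def using t t_le pos n by (intro powr_mono2') auto
      finally have n_le_y: "real n powr (\<eta> / \<gamma>) \<le> y" .
      have r: "4 * (real k0 + 1) \<le> r" "r \<le> real n" "r \<le> y"
        using elim n_le_y by (auto simp: r_def)
      have j: "real j \<le> r / 2" "r / 4 \<le> real j"
        using r by (simp_all add: j_def) linarith+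
      have decay: "\<bar>\<Prod>k=1..n. cos (t * a k)\<bar> \<le> exp (- (real j * (t * (r / 4) powr \<beta>)\<^sup>2 / 4))"
      proof (rule abs_prod_cos_le_exp)
        show "2 * j \<le> n" using j r by linarith
        fix k assume k: "j < k" "k \<le> 2 * j"
        then have "real j < real k" "real k \<le> 2 * real j" by simp_all
        then have "r / 4 \<le> real k" "real k \<le> y"
          using j r(2,3) by simp_all
        then have "k0 \<le> k" using r(1) by simp
        have "(r / 4) powr \<beta> \<le> real k powr \<beta>"
          using \<open>r / 4 \<le> real k\<close> r pos by (intro powr_mono2) auto
        also have "\<dots> \<le> a k" using k0(1)[OF \<open>k0 \<le> k\<close>] .
        finally have "(r / 4) powr \<beta> \<le> a k" .
        moreover have "a k \<le> y powr \<gamma>"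
          using k0(2)[OF \<open>k0 \<le> k\<close>] powr_mono2[of \<gamma> "real k" y] \<open>real k \<le> y\<close> pos by simp
        then have "t * a k \<le> t * y powr \<gamma>"
          using t by (intro mult_left_mono) auto
        then have "t * a k \<le> 1"
          using y by (simp add: t_y powr_minus)
        ultimately show "(r / 4) powr \<beta> \<le> a k \<and> t * a k \<le> 1" by simp
      qed (use t in auto)
      have gain: "real n powr \<kappa> \<le> r powr (1 + 2 * \<beta>) * t\<^sup>2"
      proof (cases "y \<le> real n")
        case True
        have "real n powr \<kappa> \<le> real n powr (\<eta> / \<gamma> * (1 - 4 * \<delta>))"
          using n by (intro powr_mono) (auto simp: \<kappa>_def)
        also have "\<dots> = (real n powr (\<eta> / \<gamma>)) powr (1 - 4 * \<delta>)"
          by (simp add: powr_powr)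
        also have "\<dots> \<le> y powr (1 - 4 * \<delta>)"
          using n_le_y \<delta> by (intro powr_mono2) auto
        also have "1 - 4 * \<delta> = (1 + 2 * \<beta>) + (- \<gamma> + - \<gamma>)"
          by (simp add: \<beta>_def \<gamma>_def)
        also have "y powr \<dots> = r powr (1 + 2 * \<beta>) * t\<^sup>2"
          using True by (simp only: r_def t_y powr_add power2_eq_square min_absorb2)
        finally show ?thesis .
      next
        case False
        let ?s = "- (\<alpha> + 1 / 2 - 2 * \<delta>)"
        have "real n powr \<kappa> \<le> real n powr (2 * \<delta>)"
          using n by (intro powr_mono) (auto simp: \<kappa>_def)
        also have "2 * \<delta> = (1 + 2 * \<beta>) + (?s + ?s)"
          by (simp add: \<beta>_def)
        also have "real n powr \<dots> = real n powr (1 + 2 * \<beta>) * (real n powr ?s)\<^sup>2"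
          by (simp only: powr_add power2_eq_square)
        also have "\<dots> \<le> r powr (1 + 2 * \<beta>) * t\<^sup>2"
          using False t_ge by (auto simp: r_def intro!: mult_left_mono power_mono)
        finally show ?thesis .
      qed
      have "c * real n powr \<kappa> \<le> c * (r powr (1 + 2 * \<beta>) * t\<^sup>2)"
        using gain pos by (intro mult_left_mono) auto
      also have "\<dots> = (r / 4) * (t * (r / 4) powr \<beta>)\<^sup>2 / 4"
      proof -
        have "0 < r / 4" using r(1) by simp
        have "u powr (1 + 2 * \<beta>) = u * (u powr \<beta>)\<^sup>2" if "0 < u" for u :: real
          using that by (simp only: mult_2 powr_add power2_eq_square) simp
        from this[OF \<open>0 < r / 4\<close>]
        have "(r / 4) powr (1 + 2 * \<beta>) = (r / 4) * ((r / 4) powr \<beta>)\<^sup>2" .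
        moreover have "(r / 4) powr (1 + 2 * \<beta>) = r powr (1 + 2 * \<beta>) * (1 / 4) powr (1 + 2 * \<beta>)"
          using r by (subst powr_mult[symmetric]) auto
        ultimately show ?thesis by (simp add: c_def power_mult_distrib mult_ac)
      qed
      also have "\<dots> \<le> real j * (t * (r / 4) powr \<beta>)\<^sup>2 / 4"
        using j by (intro divide_right_mono mult_right_mono) auto
      finally have "exp (- (real j * (t * (r / 4) powr \<beta>)\<^sup>2 / 4)) \<le> exp (- (c * real n powr \<kappa>))"
        by simp
      with decay show "\<bar>\<Prod>k=1..n. cos (t * a k)\<bar> \<le> exp (- (c * real n powr \<kappa>))"
        by linarith
    qed
  qed
  then show ?thesis using pos by blast
qed

section \<open>Summability and transience\<close>

text \<open>
  Taking $h = n^{-\alpha-1/2+2\delta}$ and $N \approx n^{1+\delta}$ puts all sampled frequencies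
  except 0 between $h$ and $n^{-\eta}$ with $\eta = \alpha - 1/2 - 3\delta$. The frequency 0 is responsible
  for the term $1/N$, the others for the rapidly decaying remainder, for which the power $n^{-2}$ is
  an arbitrary summable majorant.
\<close>
lemma (in rademacher_sequence) small_ball_bound:
  fixes \<alpha> \<delta> C :: real
  assumes growth: "has_growth_exponent a \<alpha>"
    and \<delta>: "0 < \<delta>" "\<delta> < 1 / 4" "3 * \<delta> < \<alpha> - 1 / 2"
  shows "\<forall>\<^sub>F n in sequentially.
      prob {w \<in> space M. \<bar>rademacher_walk \<epsilon> a n w\<bar> \<le> C}
        \<le> 8 * real n powr - (1 + \<delta>) + 4 * real n powr - 2"
proof -
  define \<eta> where "\<eta> = \<alpha> - 1 / 2 - 3 * \<delta>"
  have \<eta>: "0 < \<eta>" using \<delta> by (simp add: \<eta>_def)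
  have "\<forall>\<^sub>F n in sequentially. real n powr (\<alpha> - \<delta>) \<le> a n \<and> a n \<le> real n powr (\<alpha> + \<delta>)"
    using growth \<delta> by (simp add: has_growth_exponent_def)
  then obtain c \<kappa> where c: "0 < c" "0 < \<kappa>"
    and decay: "\<forall>\<^sub>F n in sequentially. \<forall>t.
      real n powr - (\<alpha> + 1 / 2 - 2 * \<delta>) \<le> t \<and> t \<le> real n powr - \<eta> \<longrightarrow>
      \<bar>\<Prod>k=1..n. cos (t * a k)\<bar> \<le> exp (- (c * real n powr \<kappa>))"
    using abs_prod_cos_stretched_exponential[of \<delta> \<alpha> \<eta> a] \<delta> \<eta> by auto
  have "\<forall>\<^sub>F n in sequentially. exp (- (c * real n powr \<kappa>)) \<le> real n powr - 2"
    using c by real_asymp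
  moreover have "\<forall>\<^sub>F n in sequentially. C \<le> real n powr \<eta>"
    using \<eta> by real_asymp
  moreover have "\<forall>\<^sub>F n in sequentially. 2 \<le> real n powr (1 + \<delta>)"
    using \<delta> by real_asymp
  moreover have "\<forall>\<^sub>F n in sequentially. 1 \<le> real n"
    by real_asymp
  ultimately show ?thesis
    using decay
  proof eventually_elim
    case (elim n)
    let ?X = "rademacher_walk \<epsilon> a n"
    define h where "h = real n powr - (\<alpha> + 1 / 2 - 2 * \<delta>)"
    define N where "N = nat \<lfloor>real n powr (1 + \<delta>)\<rfloor>"
    have h: "0 < h" using elim by (simp add: h_def)
    have N: "real N \<le> real n powr (1 + \<delta>)" "real n powr (1 + \<delta>) / 2 \<le> real N" "1 \<le> N"
      using elim(3) unfolding N_def by - linarith+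
    have "real N * h \<le> real n powr (1 + \<delta>) * h"
      using N h by (intro mult_right_mono) auto
    also have "\<dots> = real n powr - \<eta>"
      by (simp add: h_def \<eta>_def algebra_simps flip: powr_add)
    finally have Nh: "real N * h \<le> real n powr - \<eta>" .
    have "{w \<in> space M. \<bar>?X w\<bar> \<le> C} \<subseteq> {w \<in> space M. real N * \<bar>h * ?X w\<bar> \<le> 1}"
    proof safe
      fix w assume "\<bar>?X w\<bar> \<le> C"
      then have "real N * h * \<bar>?X w\<bar> \<le> real n powr - \<eta> * real n powr \<eta>"
        using Nh h elim(2) by (intro mult_mono) auto
      also have "\<dots> = 1"
        using elim(4) by (simp flip: powr_add)
      finally show "real N * \<bar>h * ?X w\<bar> \<le> 1"
        using h by (simp add: abs_mult)
    qed
    then have "prob {w \<in> space M. \<bar>?X w\<bar> \<le> C} \<le> prob {w \<in> space M. real N * \<bar>h * ?X w\<bar> \<le> 1}"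
      using rademacher_walk_measurable[of a n] by (intro finite_measure_mono) auto
    also have "\<dots> \<le> 4 * (1 / real N + real n powr - 2)"
    proof (rule small_ball_le_char[OF rademacher_walk_measurable \<open>1 \<le> N\<close>])
      fix j assume j: "1 \<le> j" "j < N"
      have "1 * h \<le> real j * h" "real j * h \<le> real N * h"
        using j h by (auto intro!: mult_right_mono)
      then have "\<bar>\<Prod>k=1..n. cos (real j * h * a k)\<bar> \<le> exp (- (c * real n powr \<kappa>))"
        using elim(5) Nh by (auto simp: h_def)
      then have "\<bar>\<Prod>k=1..n. cos (real j * h * a k)\<bar> \<le> real n powr - 2"
        using elim(1) by linarith
      then show "cmod (char (distr M borel ?X) (real j * h)) \<le> real n powr - 2"
        by (simp only: char_rademacher_walk norm_of_real flip: of_real_prod)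
    qed simp
    also have "1 / real N \<le> 1 / (real n powr (1 + \<delta>) / 2)"
      using N elim by (intro divide_left_mono) auto
    also have "\<dots> = 2 * real n powr - (1 + \<delta>)"
      by (simp only: powr_minus) (simp add: field_simps)
    finally show ?case by simp
  qed
qed

theorem theorem1:
  fixes M :: "'w measure" and \<epsilon> :: "nat \<Rightarrow> 'w \<Rightarrow> real"
    and a :: "nat \<Rightarrow> real" and \<alpha> :: real
  assumes "rademacher_sequence M \<epsilon>"
    and "\<And>n. n \<ge> 1 \<Longrightarrow> a n \<ge> 0"
    and "\<alpha> > 1 / 2"
    and "has_growth_exponent a \<alpha>"
  shows "transient M (rademacher_walk \<epsilon> a)"
proof -
  interpret rademacher_sequence M \<epsilon> by fact
  let ?X = "rademacher_walk \<epsilon> a"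
  define \<delta> where "\<delta> = min (1 / 8) ((\<alpha> - 1 / 2) / 6)"
  have \<delta>: "0 < \<delta>" "\<delta> < 1 / 4" "3 * \<delta> < \<alpha> - 1 / 2"
    using \<open>\<alpha> > 1 / 2\<close> by (auto simp: \<delta>_def min_def)
  have meas [measurable]: "?X n \<in> borel_measurable M" for n
    by (rule rademacher_walk_measurable)
  have "AE w in M. \<forall>\<^sub>F n in sequentially. real C < \<bar>?X n w\<bar>" for C :: nat
  proof -
    have "summable (\<lambda>n. 8 * real n powr - (1 + \<delta>) + 4 * real n powr - 2)"
      using \<delta> by (intro summable_add summable_mult) (simp_all add: summable_real_powr_iff)
    then have "summable (\<lambda>n. prob {w \<in> space M. \<bar>?X n w\<bar> \<le> real C})"
      by (rule summable_comparison_test_ev[rotated])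
         (use small_ball_bound[OF \<open>has_growth_exponent a \<alpha>\<close> \<delta>] in simp)
    then have "AE w in M. \<forall>\<^sub>F n in sequentially. w \<in> space M - {w \<in> space M. \<bar>?X n w\<bar> \<le> real C}"
      by (intro borel_cantelli_AE1) (auto simp: emeasure_eq_measure)
    then show ?thesis
      by (rule AE_mp) (auto intro!: AE_I2 elim!: eventually_mono)
  qed
  then have "AE w in M. \<forall>C::nat. \<forall>\<^sub>F n in sequentially. real C < \<bar>?X n w\<bar>"
    by (simp add: AE_all_countable)
  then have "AE w in M. \<not> (\<exists>C. infinite {n. \<bar>?X n w\<bar> \<le> C})"
  proof (rule AE_mp, intro AE_I2 impI notI, elim exE)
    fix w C
    assume escape: "\<forall>C::nat. \<forall>\<^sub>F n in sequentially. real C < \<bar>?X n w\<bar>"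
      and inf: "infinite {n. \<bar>?X n w\<bar> \<le> C}"
    obtain K :: nat where "C \<le> real K" using real_arch_simple by blast
    with escape have "\<forall>\<^sub>F n in sequentially. \<not> \<bar>?X n w\<bar> \<le> C"
      by (auto elim!: allE[of _ K] eventually_mono)
    then have "finite {n. \<bar>?X n w\<bar> \<le> C}"
      by (simp flip: cofinite_eq_sequentially add: eventually_cofinite)
    with inf show False by simp
  qed
  then have "prob {w \<in> space M. \<exists>C. infinite {n. \<bar>?X n w\<bar> \<le> C}} = 0"
    using weak_recurrence_event_measurable[of ?X M, OF meas] by (subst prob_eq_0) auto
  then show ?thesis
    by (simp add: transient_def weakly_recurrent_def)
qed

end
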